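(* For every fixed integer $l_0>0$ there exists a constant $\mathcal{C}=\mathcal{C}(l_0)>0$ such that, as $x\to\infty$, $$\sum_{n\leq x}\mu^2(n)\mu^2(n+l_0)\geq (1+o(1))\frac{18}{\pi^4}\frac{x}{\mathcal{C}(l_0)}.$$
   Context: $\mu$ is the Möbius function, so $\mu^2$ is the indicator function of squarefree integers. The sum is over positive integers $n$, and $o(1)$ denotes a quantity tending to $0$ as $x\to\infty$. *)

theory Defs
  imports
    Complex_Main
    "HOL-Computational_Algebra.Squarefree"
    "HOL-Library.Landau_Symbols"
begin

definition moebius_mu :: "nat \<Rightarrow> int" where
  "moebius_mu n = (if squarefree n then (-1) ^ card (prime_factors n) else 0)"

end

theory Submission
  imports Defs
begin

text \<open>
  A union bound suffices. A positive integer that is not squarefree is divisible by 4 or by the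
  square of an odd number \<open>k \<ge> 3\<close>, so the upper density of such integers is at most
  \<open>1/4 + 1/9 + (1/25 + 1/49 + \<dots>) \<le> 1/4 + 1/9 + 1/8 = 35/72\<close>, where the tail telescopes through
  \<open>1/k\<^sup>2 < 1/((k - 1) * (k + 1))\<close>. As this is less than \<open>1/2\<close>, excluding the integers \<open>n\<close> for which
  \<open>n\<close> or \<open>n + l0\<close> is not squarefree leaves a set of lower density at least \<open>1 - 2 * 35/72 = 1/36\<close>.
\<close>

lemma moebius_mu_power2: "(moebius_mu n)\<^sup>2 = of_bool (squarefree n)"
  by (simp add: moebius_mu_def flip: power_mult)

lemma card_multiples_le:
  assumes "d > 0"
  shows "real (card {m \<in> {1..N::nat}. d dvd m}) \<le> real N / real d"
proof -
  have "{m \<in> {1..N}. d dvd m} \<subseteq> (*) d ` {1..N div d}"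
    using assms by (auto simp: less_eq_div_iff_mult_less_eq mult.commute)
  then have "card {m \<in> {1..N}. d dvd m} \<le> card ((*) d ` {1..N div d})"
    by (intro card_mono) simp_all
  also have "\<dots> \<le> N div d"
    using card_image_le[of "{1..N div d}" "(*) d"] by simp
  finally have "card {m \<in> {1..N}. d dvd m} \<le> N div d" .
  then have "real (card {m \<in> {1..N}. d dvd m}) \<le> real (N div d)"
    by simp
  also have "\<dots> \<le> real N / real d"
    by (rule of_nat_div_le_of_nat)
  finally show ?thesis .
qed

lemma sum_inverse_odd_squares_le: "(\<Sum>j<n. 1 / real ((2 * j + 5)\<^sup>2)) \<le> 1 / 8"
proof -
  \<comment> \<open>The subtracted term makes the induction work: the right-hand side is exactly the
    telescoped sum over \<open>j < n\<close> of
    \<open>1 / ((2 * j + 4) * (2 * j + 6))\<close>.\<close>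
  have "(\<Sum>j<n. 1 / real ((2 * j + 5)\<^sup>2)) \<le> 1 / 8 - 1 / (4 * real (n + 2))"
  proof (induction n)
    case (Suc n)
    have "1 / real ((2 * n + 5)\<^sup>2) \<le> 1 / (4 * (real n + 2) * (real n + 3))"
    proof (rule frac_le)
      show "4 * (real n + 2) * (real n + 3) \<le> real ((2 * n + 5)\<^sup>2)"
        by (simp add: power2_eq_square algebra_simps)
    qed simp_all
    also have "\<dots> = 1 / (4 * real (n + 2)) - 1 / (4 * real (Suc n + 2))"
      by (simp add: divide_simps) (simp add: algebra_simps)
    finally show ?case
      using Suc by simp
  qed simp
  also have "\<dots> \<le> 1 / 8"
    by simp
  finally show ?thesis .
qed

lemma not_squarefree_cases:
  fixes m :: nat
  assumes "m > 0" "\<not> squarefree m"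
  obtains "4 dvd m" | "9 dvd m" | j where "j < m" "(2 * j + 5)\<^sup>2 dvd m"
proof -
  from assms(2) obtain d where d: "d\<^sup>2 dvd m" "d \<noteq> 1"
    by (auto simp: squarefree_def)
  consider "even d" | "d = 3" | j where "d = 2 * j + 5"
  proof -
    have "d = 3 \<or> (\<exists>j. d = 2 * j + 5)" if "odd d"
      using that d(2) by presburger
    then show thesis
      using that by blast
  qed
  then show thesis
  proof cases
    case 1
    then have "2\<^sup>2 dvd d\<^sup>2"
      by (rule dvd_power_same)
    then have "4 dvd m"
      using d(1) by (simp add: dvd_trans)
    then show thesis
      by (rule that(1))
  next
    case 2
    then show thesis
      using d(1) that(2) by simp
  next
    case 3
    have "d\<^sup>2 \<le> m"
      using d(1) assms(1) by (rule dvd_imp_le)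
    moreover have "d \<le> d\<^sup>2"
      by (simp add: power2_eq_square)
    ultimately show thesis
      using that(3)[of j] 3 d(1) by simp
  qed
qed

lemma card_not_squarefree_le:
  "real (card {m \<in> {1..N::nat}. \<not> squarefree m}) \<le> 35 / 72 * real N"
proof -
  define M where "M d = {m \<in> {1..N}. d dvd m}" for d
  have fin: "finite (M d)" for d
    by (simp add: M_def)
  \<comment> \<open>Indices below \<open>N\<close> suffice because \<open>j < m\<close> and
    \<open>m \<le> N\<close>.\<close>
  have "{m \<in> {1..N}. \<not> squarefree m} \<subseteq> M 4 \<union> (M 9 \<union> (\<Union>j<N. M ((2 * j + 5)\<^sup>2)))"
  proof
    fix m assume m: "m \<in> {m \<in> {1..N}. \<not> squarefree m}"
    then have "m > 0" "\<not> squarefree m"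
      by auto
    then show "m \<in> M 4 \<union> (M 9 \<union> (\<Union>j<N. M ((2 * j + 5)\<^sup>2)))"
      by (cases rule: not_squarefree_cases) (use m in \<open>auto simp: M_def intro: less_le_trans\<close>)
  qed
  then have "card {m \<in> {1..N}. \<not> squarefree m}
      \<le> card (M 4 \<union> (M 9 \<union> (\<Union>j<N. M ((2 * j + 5)\<^sup>2))))"
    by (intro card_mono) (simp_all add: fin)
  also have "\<dots> \<le> card (M 4) + (card (M 9) + (\<Sum>j<N. card (M ((2 * j + 5)\<^sup>2))))"
    by (intro order_trans[OF card_Un_le] add_left_mono card_UN_le) simp
  finally have "real (card {m \<in> {1..N}. \<not> squarefree m})
      \<le> real (card (M 4)) + (real (card (M 9)) + (\<Sum>j<N. real (card (M ((2 * j + 5)\<^sup>2)))))"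
    by (simp flip: of_nat_sum of_nat_add)
  also have "\<dots> \<le> real N / 4 + (real N / 9 + (\<Sum>j<N. real N / real ((2 * j + 5)\<^sup>2)))"
    using card_multiples_le[of 4 N] card_multiples_le[of 9 N]
      card_multiples_le[of "(2 * j + 5)\<^sup>2" N for j]
    unfolding M_def by (intro add_mono sum_mono) simp_all
  also have "(\<Sum>j<N. real N / real ((2 * j + 5)\<^sup>2)) = real N * (\<Sum>j<N. 1 / real ((2 * j + 5)\<^sup>2))"
    by (simp add: sum_distrib_left)
  also have "\<dots> \<le> real N * (1 / 8)"
    by (intro mult_left_mono sum_inverse_odd_squares_le) simp
  finally show ?thesis
    by simp
qed

lemma card_squarefree_pairs_ge:
  fixes N l :: nat
  shows "real (card {n \<in> {1..N}. squarefree n \<and> squarefree (n + l)})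
    \<ge> real N / 36 - 35 / 72 * real l"
proof -
  define G where "G = {n \<in> {1..N}. squarefree n \<and> squarefree (n + l)}"
  define B where "B K = {m \<in> {1..K::nat}. \<not> squarefree m}" for K
  define B' where "B' = {n \<in> {1..N}. \<not> squarefree (n + l)}"
  have fin: "finite G" "finite B'" "finite (B K)" for K
    by (simp_all add: G_def B'_def B_def)
  \<comment> \<open>Translation by \<open>l\<close> embeds \<open>B'\<close> into the non-squarefree
    integers up to \<open>N + l\<close>; the longer interval is the source of the loss
    \<open>35 / 72 * l\<close>.\<close>
  have "card B' \<le> card (B (N + l))"
    by (rule card_inj_on_le[where f = "\<lambda>n. n + l"]) (auto simp: B'_def B_def)
  moreover have "N \<le> card G + (card (B N) + card B')"
  proof -
    have "{1..N} \<subseteq> G \<union> (B N \<union> B')"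
      by (auto simp: G_def B_def B'_def)
    then have "N \<le> card (G \<union> (B N \<union> B'))"
      using card_mono[of "G \<union> (B N \<union> B')" "{1..N}"] fin by simp
    also have "\<dots> \<le> card G + (card (B N) + card B')"
      by (intro order_trans[OF card_Un_le] add_left_mono card_Un_le)
    finally show ?thesis .
  qed
  ultimately have "real N \<le> real (card G) + (real (card (B N)) + real (card (B (N + l))))"
    by linarith
  then show ?thesis
    using card_not_squarefree_le[of N] card_not_squarefree_le[of "N + l"]
    unfolding G_def B_def by simp
qed

theorem corollary4p4:
  fixes l0 :: nat
  assumes "l0 > 0"
  shows "\<exists>C::real. C > 0 \<and>
    (\<exists>\<epsilon> :: real \<Rightarrow> real. \<epsilon> \<in> o[at_top](\<lambda>_. 1) \<and>
      (\<forall>\<^sub>F x in at_top.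
        (\<Sum>n | n > 0 \<and> real n \<le> x.
            real_of_int ((moebius_mu n)\<^sup>2 * (moebius_mu (n + l0))\<^sup>2))
          \<ge> (1 + \<epsilon> x) * (18 / pi ^ 4) * (x / C)))"
proof (intro exI conjI)
  \<comment> \<open>The witness for \<open>C\<close> turns the main term into \<open>x / 72\<close>,
    half of what the density bound \<open>1 / 36\<close> gives. The other half absorbs all
    lower-order errors, so \<open>\<epsilon> = 0\<close> is possible.\<close>
  show "18 * 72 / pi ^ 4 > 0"
    by simp
  show "(\<lambda>_. 0) \<in> o[at_top](\<lambda>_::real. 1::real)"
    by simp
  show "\<forall>\<^sub>F x in at_top.
      (1 + 0) * (18 / pi ^ 4) * (x / (18 * 72 / pi ^ 4))
        \<le> (\<Sum>n | n > 0 \<and> real n \<le> x.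
            real_of_int ((moebius_mu n)\<^sup>2 * (moebius_mu (n + l0))\<^sup>2))"
    \<comment> \<open>This threshold is equivalent to
      \<open>x / 72 \<le> (x - 1) / 36 - 35 / 72 * l0\<close>, where \<open>x - 1\<close> accounts
      for rounding \<open>x\<close> down to \<open>N\<close>.\<close>
    using eventually_ge_at_top[of "35 * real l0 + 2"]
  proof eventually_elim
    case (elim x)
    define N where "N = nat \<lfloor>x\<rfloor>"
    have set_eq: "{n. n > 0 \<and> real n \<le> x} = {1..N}"
      using elim by (auto simp: N_def le_nat_floor le_nat_iff le_floor_iff)
    have "x - 1 \<le> real N"
      unfolding N_def by linarith
    have "(1 + 0) * (18 / pi ^ 4) * (x / (18 * 72 / pi ^ 4)) = x / 72"
      by simp
    also have "\<dots> \<le> (x - 1) / 36 - 35 / 72 * real l0"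
      using elim by (simp add: field_simps)
    also have "\<dots> \<le> real N / 36 - 35 / 72 * real l0"
      using \<open>x - 1 \<le> real N\<close> by simp
    also have "\<dots> \<le> real (card {n \<in> {1..N}. squarefree n \<and> squarefree (n + l0)})"
      by (rule card_squarefree_pairs_ge)
    also have "\<dots> = (\<Sum>n | n > 0 \<and> real n \<le> x.
        real_of_int ((moebius_mu n)\<^sup>2 * (moebius_mu (n + l0))\<^sup>2))"
      \<comment> \<open>Each summand is now a product of two indicators, hence the indicator of the
        conjunction, and the sum counts the pairs.\<close>
      unfolding set_eq moebius_mu_power2
      by (simp add: sum.If_cases Int_def flip: of_bool_conj)
    finally show ?case .
  qed
qed

end
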